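(* Let $(S,\sim,\boxplus,|\cdot|)$ be a submodular uncrossing-setting on a finite set $S$ of separations. Then the set of friendly separations in $S$ is nested.
   Context: A separation is a set $\{A,B\}$ with $A\neq B$; $A,B$ are its (opposite) sides. An uncrossing-setting on a set $S$ of separations is a pair $(S,\sim)$ with $\sim$ an anti-reflexive symmetric relation on $S$; $r\sim s$ is read "$r$ and $s$ cross", and non-crossing elements are nested; a subset is nested if its elements are pairwise nested. A corner-map assigns to every unordered pair of crossing $r=\{A,B\},s=\{C,D\}\in S$ four pairwise distinct separations $L(X,Y)$, one for each $X\in\{A,B\}$, $Y\in\{C,D\}$ (the corners of $r,s$; they need not lie in $S$; those in $S$ are $S$-corners). Corners $L(X,Y)\neq L(X',Y')$ are opposite if $X\neq X'$ and $Y\neq Y'$, adjacent otherwise; they lie on the same side of $r$ if $X=X'$ and on the same side of $s$ if $Y=Y'$. The corner-map must satisfy (F): for every two opposite $S$-corners $c,d$ of crossing $r,s$: (F1) if $t\in S$ crosses at least one of $c,d$ then $t$ crosses at least one of $r,s$; (F2) if $t\in S$ crosses both $c$ and $d$ then $t$ crosses both $r$ and $s$; (F3) neither $r$ nor $s$ crosses $c$ or $d$. An order-function assigns a value $|\cdot|\in\mathbb{R}_{\ge0}$ to each element of $S$ and each corner of crossing pairs in $S$; it is submodular if $|c|+|d|\le|r|+|s|$ for all crossing $r,s\in S$ and opposite corners $c,d$. A submodular uncrossing-setting is $(S,\sim,\boxplus,|\cdot|)$ with these properties. An entanglement is a non-empty $\varepsilon\subseteq S$ such that: if $r\in\varepsilon$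 is crossed by some $s\in S$ so that two adjacent corners on the same side of $r$ have order at most $|r|$, then at least one of these corners has order equal to $|r|$ and lies in $\varepsilon$. A separation $s\in S$ is friendly if it lies in some entanglement $\varepsilon$ such that no other separation in $\varepsilon$ crosses fewer separations lying in entanglements than $s$ does. *)

theory Defs
  imports Complex_Main
begin

definition separation :: "'a set \<Rightarrow> bool" where
  "separation s \<longleftrightarrow> (\<exists>A B. A \<noteq> B \<and> s = {A, B})"

definition uncrossing_setting :: "'a set set \<Rightarrow> 'a set rel \<Rightarrow> bool" where
  "uncrossing_setting S cross \<longleftrightarrow>
     (\<forall>s\<in>S. separation s) \<and> cross \<subseteq> S \<times> S \<and> irrefl cross \<and> sym cross"

definition nested :: "'a set rel \<Rightarrow> 'a set set \<Rightarrow> bool" where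
  "nested cross N \<longleftrightarrow> pairwise (\<lambda>r s. (r, s) \<notin> cross) N"

text \<open>
  A corner-map is a function \<open>L\<close>, where \<open>L r s X Y\<close> is the corner of the crossing pair
  \<open>r, s\<close> for the sides \<open>X \<in> r\<close> and \<open>Y \<in> s\<close>; its values at other arguments are irrelevant.
  The pair \<open>r, s\<close> is unordered, which \<open>corner_map\<close> below expresses by
  \<open>L r s X Y = L s r Y X\<close>.
\<close>

type_synonym 'a corners = "'a set \<Rightarrow> 'a set \<Rightarrow> 'a \<Rightarrow> 'a \<Rightarrow> 'a set"

definition opposite_corners ::
    "'a corners \<Rightarrow> 'a set \<Rightarrow> 'a set \<Rightarrow> 'a set \<Rightarrow> 'a set \<Rightarrow> bool" where
  "opposite_corners L r s c d \<longleftrightarrow>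
     (\<exists>X\<in>r. \<exists>X'\<in>r. \<exists>Y\<in>s. \<exists>Y'\<in>s. X \<noteq> X' \<and> Y \<noteq> Y' \<and> c = L r s X Y \<and> d = L r s X' Y')"

text \<open>
  Two distinct corners on the same side \<open>X\<close> of the \<^emph>\<open>first\<close> separation \<open>r\<close>; such corners
  are automatically adjacent. For the same side of \<open>s\<close>, swap \<open>r\<close> and \<open>s\<close>.
\<close>

definition adjacent_same_side ::
    "'a corners \<Rightarrow> 'a set \<Rightarrow> 'a set \<Rightarrow> 'a set \<Rightarrow> 'a set \<Rightarrow> bool" where
  "adjacent_same_side L r s c d \<longleftrightarrow>
     (\<exists>X\<in>r. \<exists>Y\<in>s. \<exists>Y'\<in>s. Y \<noteq> Y' \<and> c = L r s X Y \<and> d = L r s X Y')"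

definition corner_map :: "'a set set \<Rightarrow> 'a set rel \<Rightarrow> 'a corners \<Rightarrow> bool" where
  "corner_map S cross L \<longleftrightarrow>
     (\<forall>r s. (r, s) \<in> cross \<longrightarrow>
        (\<forall>X\<in>r. \<forall>Y\<in>s. separation (L r s X Y) \<and> L r s X Y = L s r Y X) \<and>
        inj_on (\<lambda>(X, Y). L r s X Y) (r \<times> s) \<and>
        (\<forall>c\<in>S. \<forall>d\<in>S. opposite_corners L r s c d \<longrightarrow>
           (\<forall>t\<in>S. (t, c) \<in> cross \<or> (t, d) \<in> cross \<longrightarrow> (t, r) \<in> cross \<or> (t, s) \<in> cross) \<and>
           (\<forall>t\<in>S. (t, c) \<in> cross \<and> (t, d) \<in> cross \<longrightarrow> (t, r) \<in> cross \<and> (t, s) \<in> cross) \<and>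
           (r, c) \<notin> cross \<and> (r, d) \<notin> cross \<and> (s, c) \<notin> cross \<and> (s, d) \<notin> cross))"

definition order_function ::
    "'a set set \<Rightarrow> 'a set rel \<Rightarrow> 'a corners \<Rightarrow> ('a set \<Rightarrow> real) \<Rightarrow> bool" where
  "order_function S cross L ordr \<longleftrightarrow>
     (\<forall>s\<in>S. 0 \<le> ordr s) \<and>
     (\<forall>r s. (r, s) \<in> cross \<longrightarrow> (\<forall>X\<in>r. \<forall>Y\<in>s. 0 \<le> ordr (L r s X Y)))"

definition submodular ::
    "'a set rel \<Rightarrow> 'a corners \<Rightarrow> ('a set \<Rightarrow> real) \<Rightarrow> bool" where
  "submodular cross L ordr \<longleftrightarrow>
     (\<forall>r s c d. (r, s) \<in> cross \<longrightarrow> opposite_corners L r s c d \<longrightarrow>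
        ordr c + ordr d \<le> ordr r + ordr s)"

definition submodular_uncrossing_setting ::
    "'a set set \<Rightarrow> 'a set rel \<Rightarrow> 'a corners \<Rightarrow> ('a set \<Rightarrow> real) \<Rightarrow> bool" where
  "submodular_uncrossing_setting S cross L ordr \<longleftrightarrow>
     uncrossing_setting S cross \<and> corner_map S cross L \<and>
     order_function S cross L ordr \<and> submodular cross L ordr"

definition entanglement ::
    "'a set set \<Rightarrow> 'a set rel \<Rightarrow> 'a corners \<Rightarrow> ('a set \<Rightarrow> real) \<Rightarrow> 'a set set \<Rightarrow> bool" where
  "entanglement S cross L ordr \<epsilon> \<longleftrightarrow>
     \<epsilon> \<noteq> {} \<and> \<epsilon> \<subseteq> S \<and>
     (\<forall>r\<in>\<epsilon>. \<forall>s\<in>S. \<forall>c d. (r, s) \<in> cross \<longrightarrow> adjacent_same_side L r s c d \<longrightarrow>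
        ordr c \<le> ordr r \<longrightarrow> ordr d \<le> ordr r \<longrightarrow>
        (ordr c = ordr r \<and> c \<in> \<epsilon>) \<or> (ordr d = ordr r \<and> d \<in> \<epsilon>))"

definition crossing_number ::
    "'a set set \<Rightarrow> 'a set rel \<Rightarrow> 'a corners \<Rightarrow> ('a set \<Rightarrow> real) \<Rightarrow> 'a set \<Rightarrow> nat" where
  "crossing_number S cross L ordr s =
     card {t \<in> S. (s, t) \<in> cross \<and> (\<exists>\<epsilon>. entanglement S cross L ordr \<epsilon> \<and> t \<in> \<epsilon>)}"

definition friendly ::
    "'a set set \<Rightarrow> 'a set rel \<Rightarrow> 'a corners \<Rightarrow> ('a set \<Rightarrow> real) \<Rightarrow> 'a set \<Rightarrow> bool" where
  "friendly S cross L ordr s \<longleftrightarrow>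
     s \<in> S \<and>
     (\<exists>\<epsilon>. entanglement S cross L ordr \<epsilon> \<and> s \<in> \<epsilon> \<and>
        \<not> (\<exists>s'\<in>\<epsilon>. s' \<noteq> s \<and>
             crossing_number S cross L ordr s' < crossing_number S cross L ordr s))"

end

(*
  Let r and s be crossing friendly separations, lying in entanglements witnessing this. If c, d
  are opposite corners in S, then (F1)-(F3) show that c and d together cross strictly fewer
  separations from entanglements than r and s do: no t is counted more often, and s, which
  crosses r, crosses neither c nor d. Submodularity and the two entanglements yield, up to
  symmetry, either opposite corners with one in each entanglement, contradicting the minimality
  of r and s; or one opposite pair in each entanglement, in which case r would cross more than s
  and s more than r.
*)

theory Submission
  imports Defs
begin

lemma separationE:
  assumes "separation s"
  obtains A B where "A \<noteq> B" "s = {A, B}"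
  using assms by (auto simp: separation_def)

lemma opposite_cornersI:
  "\<lbrakk>X \<in> r; X' \<in> r; Y \<in> s; Y' \<in> s; X \<noteq> X'; Y \<noteq> Y'\<rbrakk>
    \<Longrightarrow> opposite_corners L r s (L r s X Y) (L r s X' Y')"
  unfolding opposite_corners_def by blast

lemma adjacent_same_sideI:
  "\<lbrakk>X \<in> r; Y \<in> s; Y' \<in> s; Y \<noteq> Y'\<rbrakk> \<Longrightarrow> adjacent_same_side L r s (L r s X Y) (L r s X Y')"
  unfolding adjacent_same_side_def by blast

lemma entanglement_adjacent_corners:
  assumes "entanglement S cross L ordr \<epsilon>" "r \<in> \<epsilon>" "s \<in> S" "(r, s) \<in> cross"
    and "adjacent_same_side L r s c d" "ordr c \<le> ordr r" "ordr d \<le> ordr r"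
  shows "ordr c = ordr r \<and> c \<in> \<epsilon> \<or> ordr d = ordr r \<and> d \<in> \<epsilon>"
  using assms unfolding entanglement_def by blast

text \<open>By inclusion-exclusion each sum of two cardinalities is that of the union plus that of
  the intersection. (F1) bounds the union and (F2) the intersection. Strictness comes from
  \<open>s\<close>: it crosses \<open>r\<close>, so it lies in the union on the right, but by (F3)
  not in the one on the left.\<close>

lemma card_crossing_opposite_corners_less:
  assumes cm: "corner_map S cross L" and "sym cross" and fin: "finite T" and TS: "T \<subseteq> S"
    and rs: "(r, s) \<in> cross" and sT: "s \<in> T"
    and cS: "c \<in> S" and dS: "d \<in> S" and opp: "opposite_corners L r s c d"
  shows "card {t\<in>T. (c, t) \<in> cross} + card {t\<in>T. (d, t) \<in> cross}
       < card {t\<in>T. (r, t) \<in> cross} + card {t\<in>T. (s, t) \<in> cross}"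
proof -
  let ?N = "\<lambda>x. {t\<in>T. (x, t) \<in> cross}"
  have sym: "(x, y) \<in> cross \<longleftrightarrow> (y, x) \<in> cross" for x y
    using \<open>sym cross\<close> by (meson symD)
  have F1: "\<forall>t\<in>S. (t, c) \<in> cross \<or> (t, d) \<in> cross \<longrightarrow> (t, r) \<in> cross \<or> (t, s) \<in> cross"
    and F2: "\<forall>t\<in>S. (t, c) \<in> cross \<and> (t, d) \<in> cross \<longrightarrow> (t, r) \<in> cross \<and> (t, s) \<in> cross"
    and F3: "(s, c) \<notin> cross" "(s, d) \<notin> cross"
    using cm rs cS dS opp unfolding corner_map_def by blast+
  have fin': "finite (?N x)" for x
    using fin by simp
  have "?N c \<union> ?N d \<subset> ?N r \<union> ?N s"
  proof
    show "?N c \<union> ?N d \<subseteq> ?N r \<union> ?N s"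
      using F1 TS sym by blast
    show "?N c \<union> ?N d \<noteq> ?N r \<union> ?N s"
      using F3 rs sT sym by blast
  qed
  then have "card (?N c \<union> ?N d) < card (?N r \<union> ?N s)"
    by (simp add: fin' psubset_card_mono)
  moreover have "card (?N c \<inter> ?N d) \<le> card (?N r \<inter> ?N s)"
    using F2 TS sym by (intro card_mono finite_Int) (use fin' in blast)+
  ultimately show ?thesis
    using card_Un_Int[OF fin' fin', of c d] card_Un_Int[OF fin' fin', of r s] by linarith
qed

text \<open>The preceding count, with \<open>T\<close> the set of all separations that lie in
  entanglements; \<epsilon> serves to put \<open>s\<close> into \<open>T\<close>.\<close>

lemma crossing_number_opposite_corners_less:
  assumes sus: "submodular_uncrossing_setting S cross L ordr" and fin: "finite S"
    and rs: "(r, s) \<in> cross" and ent: "entanglement S cross L ordr \<epsilon>" "s \<in> \<epsilon>"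
    and "c \<in> S" "d \<in> S" "opposite_corners L r s c d"
  shows "crossing_number S cross L ordr c + crossing_number S cross L ordr d
       < crossing_number S cross L ordr r + crossing_number S cross L ordr s"
proof -
  define T where "T = {t\<in>S. \<exists>\<epsilon>. entanglement S cross L ordr \<epsilon> \<and> t \<in> \<epsilon>}"
  have eq: "crossing_number S cross L ordr x = card {t\<in>T. (x, t) \<in> cross}" for x
    unfolding crossing_number_def T_def by (rule arg_cong[where f = card]) blast
  have "s \<in> S"
    using sus rs unfolding submodular_uncrossing_setting_def uncrossing_setting_def by blast
  then have "s \<in> T"
    using ent unfolding T_def by blast
  moreover have "finite T" "T \<subseteq> S"
    using fin unfolding T_def by auto
  ultimately show ?thesis
    unfolding eq using assms
    by (intro card_crossing_opposite_corners_less)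
      (auto simp: submodular_uncrossing_setting_def uncrossing_setting_def)
qed

text \<open>
  The sides of \<open>r\<close> are \<open>{ac, ad}\<close> and \<open>{bc, bd}\<close>, those of \<open>s\<close> are \<open>{ac, bc}\<close> and \<open>{ad, bd}\<close>;
  \<open>E\<close> and \<open>D\<close> are the entanglements containing \<open>r\<close> and \<open>s\<close>, and \<open>n\<close> is the crossing number.
\<close>

lemma no_four_corners:
  fixes f :: "'b \<Rightarrow> real" and n :: "'b \<Rightarrow> nat"
  assumes submod: "f ac + f bd \<le> f r + f s" "f ad + f bc \<le> f r + f s"
    and E: "\<And>c d. (c, d) \<in> {(ac, ad), (bc, bd)} \<Longrightarrow> f c \<le> f r \<Longrightarrow> f d \<le> f r \<Longrightarrow>
              f c = f r \<and> c \<in> E \<or> f d = f r \<and> d \<in> E"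
    and D: "\<And>c d. (c, d) \<in> {(ac, bc), (ad, bd)} \<Longrightarrow> f c \<le> f s \<Longrightarrow> f d \<le> f s \<Longrightarrow>
              f c = f s \<and> c \<in> D \<or> f d = f s \<and> d \<in> D"
    and minE: "\<And>c. c \<in> E \<Longrightarrow> c \<in> S \<and> n r \<le> n c"
    and minD: "\<And>c. c \<in> D \<Longrightarrow> c \<in> S \<and> n s \<le> n c"
    and less: "ac \<in> S \<Longrightarrow> bd \<in> S \<Longrightarrow> n ac + n bd < n r + n s"
      "ad \<in> S \<Longrightarrow> bc \<in> S \<Longrightarrow> n ad + n bc < n r + n s"
  shows False
proof -
  have less': "n c + n d < n r + n s"
    if "(c, d) \<in> {(ac, bd), (bd, ac), (ad, bc), (bc, ad)}" "c \<in> S" "d \<in> S" for c d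
    using that less by (auto simp: add.commute)
  have opposite: "\<not> (c \<in> E \<and> d \<in> D)"
    if "(c, d) \<in> {(ac, bd), (bd, ac), (ad, bc), (bc, ad)}" for c d
    using minE[of c] minD[of d] less'[OF that] by fastforce
  \<comment> \<open>By \<open>minE\<close> and \<open>less'\<close>, 2 * n r \<le> n c + n d < n r +
    n s, so n r < n s; the pair in \<open>D\<close> likewise gives n s < n r.\<close>
  have both: "\<not> (c \<in> E \<and> d \<in> E \<and> c' \<in> D \<and> d' \<in> D)"
    if cd: "(c, d) \<in> {(ac, bd), (ad, bc)}" "(c', d') \<in> {(ac, bd), (ad, bc)}" for c d c' d'
  proof
    assume mem: "c \<in> E \<and> d \<in> E \<and> c' \<in> D \<and> d' \<in> D"
    then have "n c + n d < n r + n s" "n c' + n d' < n r + n s"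
      using cd minE minD by (auto intro!: less')
    moreover have "n r \<le> n c" "n r \<le> n d" "n s \<le> n c'" "n s \<le> n d'"
      using mem minE minD by auto
    ultimately show False
      by linarith
  qed
  have E': "f ac \<le> f r \<Longrightarrow> f ad \<le> f r \<Longrightarrow> f ac = f r \<and> ac \<in> E \<or> f ad = f r \<and> ad \<in> E"
    "f bc \<le> f r \<Longrightarrow> f bd \<le> f r \<Longrightarrow> f bc = f r \<and> bc \<in> E \<or> f bd = f r \<and> bd \<in> E"
    using E by auto
  have D': "f ac \<le> f s \<Longrightarrow> f bc \<le> f s \<Longrightarrow> f ac = f s \<and> ac \<in> D \<or> f bc = f s \<and> bc \<in> D"
    "f ad \<le> f s \<Longrightarrow> f bd \<le> f s \<Longrightarrow> f ad = f s \<and> ad \<in> D \<or> f bd = f s \<and> bd \<in> D"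
    using D by auto
  \<comment> \<open>By symmetry let f r \<le> f s. If each side of \<open>r\<close> has a corner of
    order above f r, then by \<open>submod\<close> some side of \<open>s\<close> has both corners of
    order below f s, against \<open>D'\<close>. Otherwise let \<open>ac\<close> and
    \<open>ad\<close> have order at most f r, with \<open>ac\<close> in \<open>E\<close> and f ac =
    f r by \<open>E'\<close>. Then f bd \<le> f s, so \<open>D'\<close> and \<open>opposite\<close>
    put \<open>ad\<close> in \<open>D\<close> with f ad = f s, whence f r = f s and f bc \<le> f r.
    Now \<open>E'\<close> and \<open>opposite\<close> put \<open>bd\<close> in \<open>E\<close>,
    then \<open>D'\<close> and \<open>opposite\<close> put \<open>bc\<close> in \<open>D\<close>,
    against \<open>both\<close>.\<close>
  show False
    using submod E' D' opposite[of ac bd] opposite[of bd ac] opposite[of ad bc] opposite[of bc ad]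
      both[of ac bd ad bc] both[of ad bc ac bd]
    by simp (smt (verit))
qed

theorem theorem5p3:
  fixes S :: "'a set set" and cross :: "'a set rel"
    and L :: "'a corners" and ordr :: "'a set \<Rightarrow> real"
  assumes "submodular_uncrossing_setting S cross L ordr"
    and "finite S"
  shows "nested cross {s \<in> S. friendly S cross L ordr s}"
proof -
  let ?n = "crossing_number S cross L ordr"
  have sep: "\<And>s. s \<in> S \<Longrightarrow> separation s" and "sym cross"
    and cm: "corner_map S cross L" and sub: "submodular cross L ordr"
    using assms(1) unfolding submodular_uncrossing_setting_def uncrossing_setting_def by auto
  have False
    if rs: "(r, s) \<in> cross" and "r \<in> S" "s \<in> S"
      and fr: "friendly S cross L ordr r" and fs: "friendly S cross L ordr s" for r s
  proof -
    \<comment> \<open>Friendliness compares \<open>r\<close> only with the other members of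
      \<open>E\<close>; for c = r the bound is reflexivity.\<close>
    obtain E where E: "entanglement S cross L ordr E" "r \<in> E" and "\<And>c. c \<in> E \<Longrightarrow> ?n r \<le> ?n c"
      using fr unfolding friendly_def by (metis order_refl not_le)
    then have minE: "c \<in> S \<and> ?n r \<le> ?n c" if "c \<in> E" for c
      using that unfolding entanglement_def by blast
    obtain D where D: "entanglement S cross L ordr D" "s \<in> D" and "\<And>c. c \<in> D \<Longrightarrow> ?n s \<le> ?n c"
      using fs unfolding friendly_def by (metis order_refl not_le)
    then have minD: "c \<in> S \<and> ?n s \<le> ?n c" if "c \<in> D" for c
      using that unfolding entanglement_def by blast
    obtain A B where AB: "A \<noteq> B" "r = {A, B}"
      using sep \<open>r \<in> S\<close> by (blast elim: separationE)
    obtain C C' where CC': "C \<noteq> C'" "s = {C, C'}"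
      using sep \<open>s \<in> S\<close> by (blast elim: separationE)
    have sr: "(s, r) \<in> cross"
      using rs \<open>sym cross\<close> by (rule symD[rotated])
    have opp: "opposite_corners L r s (L r s A C) (L r s B C')"
      "opposite_corners L r s (L r s A C') (L r s B C)"
      using AB CC' by (auto intro: opposite_cornersI)
    \<comment> \<open>The entanglement \<open>D\<close> constrains corners written as
      \<open>L s r Y X\<close>; this identifies them with the corners \<open>L r s X Y\<close> used
      for \<open>E\<close>.\<close>
    have L_swap: "L r s X Y = L s r Y X" if "X \<in> r" "Y \<in> s" for X Y
      using cm rs that unfolding corner_map_def by blast
    have adjE: "adjacent_same_side L r s c d"
      if "(c, d) \<in> {(L r s A C, L r s A C'), (L r s B C, L r s B C')}" for c d
      using that AB CC' by (auto intro: adjacent_same_sideI)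
    have "adjacent_same_side L s r (L s r Y A) (L s r Y B)" if "Y \<in> s" for Y
      using that AB by (auto intro: adjacent_same_sideI)
    then have adjD: "adjacent_same_side L s r c d"
      if "(c, d) \<in> {(L r s A C, L r s B C), (L r s A C', L r s B C')}" for c d
      using that L_swap AB(2) CC'(2) by auto
    have submod: "ordr c + ordr d \<le> ordr r + ordr s" if "opposite_corners L r s c d" for c d
      using sub rs that unfolding submodular_def by blast
    note less = crossing_number_opposite_corners_less[OF assms rs D]
    show False
      by (rule no_four_corners[OF submod[OF opp(1)] submod[OF opp(2)]
            entanglement_adjacent_corners[OF E \<open>s \<in> S\<close> rs adjE]
            entanglement_adjacent_corners[OF D \<open>r \<in> S\<close> sr adjD]
            minE minD less[OF _ _ opp(1)] less[OF _ _ opp(2)]])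
  qed
  then show ?thesis
    unfolding nested_def pairwise_def by blast
qed

end
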